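(* Let $\Lambda$ be a non-zero, locally finite and translation invariant measure on the set $\mathcal{H}$ of affine hyperplanes of $\mathbb{R}^\ell$, such that there is no line in $\mathbb{R}^\ell$ with the property that all hyperplanes of the support of $\Lambda$ are parallel to it. Let $Y^{\rm PHT}$ be a Poisson hyperplane tessellation of $\mathbb{R}^\ell$ with intensity measure $\Lambda$. Then the tail $\sigma$-algebra $\mathcal{B}_{-\infty}(\mathbb{T})$ is not trivial with respect to the distribution of $Y^{\rm PHT}$; that is, there is $\mathcal{D}\in\mathcal{B}_{-\infty}(\mathbb{T})$ with $0<\mathbb{P}(Y^{\rm PHT}\in\mathcal{D})<1$.
   Context: For $B\subseteq\mathbb{R}^\ell$ let $[B]=\{H\in\mathcal{H}:H\cap B\neq\emptyset\}$; locally finite means $\Lambda([B])<\infty$ for every bounded $B$. A tessellation $T$ of $\mathbb{R}^\ell$ is a locally finite countable set of compact convex polytopes with non-empty interiors (the cells), with pairwise disjoint interiors and with union $\mathbb{R}^\ell$; $\partial T$ is the union of the boundaries of its cells (a closed set that determines $T$). $\mathbb{T}$ is the set of all tessellations of $\mathbb{R}^\ell$. The Poisson hyperplane tessellation $Y^{\rm PHT}$ with intensity measure $\Lambda$ is the random tessellation for which $\partial Y^{\rm PHT}$ is the union of the hyperplanes of a Poisson process on $\mathcal{H}$ with intensity measure $\Lambda$ (under the assumptions on $\Lambda$ the cells are a.s. bounded). A window is a compact convex polytope in $\mathbb{R}^\ell$ with non-empty interior. For a window $W$ with complement $W^c$, $\mathcal{B}(\mathbb{T}_{W^c})$ is the $\sigma$-algebra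 on $\mathbb{T}$ generated by the sets $\{T\in\mathbb{T}:\partial T\cap C=\emptyset\}$ with $C\subset W^c$ compact. The tail $\sigma$-algebra is $\mathcal{B}_{-\infty}(\mathbb{T})=\bigcap_{n=1}^\infty\mathcal{B}(\mathbb{T}_{W_n^c})$, where $(W_n)$ is any increasing sequence of windows with $W_n\subset\operatorname{int}W_{n+1}$ for all $n$ and $\bigcup_nW_n=\mathbb{R}^\ell$ (it does not depend on the choice of the sequence; e.g. $W_n=[-n,n]^\ell$). *)

theory Defs
  imports "HOL-Probability.Probability"
begin

definition hyperplanes :: "'a::euclidean_space set set" where
  "hyperplanes = {{x. a \<bullet> x = b} | a b. a \<noteq> 0}"

definition hitting :: "'a::euclidean_space set \<Rightarrow> 'a set set" where
  "hitting B = {H \<in> hyperplanes. H \<inter> B \<noteq> {}}"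

(* The Fell topology, restricted to the hyperplanes. Taking C = {} shows that its
   underlying space is all of hyperplanes. *)
definition hyperplane_topology :: "'a::euclidean_space set topology" where
  "hyperplane_topology = topology_generated_by
     ({hyperplanes - hitting C | C. compact C} \<union> {hitting G | G. open G})"

definition hyperplane_borel :: "'a::euclidean_space set measure" where
  "hyperplane_borel = sigma hyperplanes {U. openin hyperplane_topology U}"

definition locally_finite_measure :: "'a::euclidean_space set measure \<Rightarrow> bool" where
  "locally_finite_measure \<Lambda> \<longleftrightarrow> (\<forall>B. bounded B \<longrightarrow> emeasure \<Lambda> (hitting B) < \<infinity>)"

definition translation_invariant :: "'a::euclidean_space set measure \<Rightarrow> bool" where
  "translation_invariant \<Lambda> \<longleftrightarrow>
     (\<forall>v. \<forall>A \<in> sets \<Lambda>. emeasure \<Lambda> ((\<lambda>H. (+) v ` H) ` A) = emeasure \<Lambda> A)"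

definition measure_support :: "'a::euclidean_space set measure \<Rightarrow> 'a set set" where
  "measure_support \<Lambda> =
     {H \<in> hyperplanes. \<forall>U. openin hyperplane_topology U \<and> H \<in> U \<longrightarrow> emeasure \<Lambda> U > 0}"

definition is_line :: "'a::euclidean_space set \<Rightarrow> bool" where
  "is_line L \<longleftrightarrow> affine L \<and> aff_dim L = 1"

(* Parallelism of flats of possibly different dimensions: the direction space of one of
   them contains that of the other. In dimension at least 2 a hyperplane is parallel to a
   line iff some translate of the line lies in the hyperplane. In dimension 1, where
   hyperplanes are points, every hyperplane is parallel to the only line. *)
definition parallel_flats :: "'a::euclidean_space set \<Rightarrow> 'a set \<Rightarrow> bool" where
  "parallel_flats S T \<longleftrightarrow> (\<exists>v. (+) v ` S \<subseteq> T \<or> (+) v ` T \<subseteq> S)"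

definition npoints :: "('w \<Rightarrow> 'h set) \<Rightarrow> 'h set \<Rightarrow> 'w \<Rightarrow> ennreal" where
  "npoints \<Phi> A \<omega> = emeasure (count_space UNIV) (\<Phi> \<omega> \<inter> A)"

(* A Poisson process represented by its random set of points. No multiplicities are needed
   for a diffuse intensity measure, and a locally finite translation invariant measure on
   hyperplanes is diffuse. *)
definition poisson_process :: "'w measure \<Rightarrow> 'h measure \<Rightarrow> ('w \<Rightarrow> 'h set) \<Rightarrow> bool" where
  "poisson_process M \<Lambda> \<Phi> \<longleftrightarrow>
     prob_space M \<and>
     (\<forall>\<omega> \<in> space M. \<Phi> \<omega> \<subseteq> space \<Lambda>) \<and>
     (\<forall>A \<in> sets \<Lambda>. npoints \<Phi> A \<in> borel_measurable M) \<and>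
     (\<forall>A \<in> sets \<Lambda>. emeasure \<Lambda> A < \<infinity> \<longrightarrow>
        (\<forall>k. \<P>(\<omega> in M. npoints \<Phi> A \<omega> = of_nat k)
              = exp (- measure \<Lambda> A) * measure \<Lambda> A ^ k / fact k)) \<and>
     (\<forall>A \<in> sets \<Lambda>. emeasure \<Lambda> A = \<infinity> \<longrightarrow> (AE \<omega> in M. npoints \<Phi> A \<omega> = \<infinity>)) \<and>
     (\<forall>(A :: nat \<Rightarrow> 'h set) n. A ` {..<n} \<subseteq> sets \<Lambda> \<and> disjoint_family_on A {..<n} \<longrightarrow>
        prob_space.indep_vars M (\<lambda>_. borel) (\<lambda>i. npoints \<Phi> (A i)) {..<n})"

(* The library's polytope means the convex hull of a finite set, so it is compact and convex. *)
definition tessellations :: "'a::euclidean_space set set set" where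
  "tessellations = {T. countable T \<and>
     (\<forall>B. bounded B \<longrightarrow> finite {C \<in> T. C \<inter> B \<noteq> {}}) \<and>
     (\<forall>C \<in> T. polytope C \<and> interior C \<noteq> {}) \<and>
     pairwise (\<lambda>C D. interior C \<inter> interior D = {}) T \<and>
     \<Union>T = UNIV}"

definition tess_boundary :: "'a::euclidean_space set set \<Rightarrow> 'a set" where
  "tess_boundary T = (\<Union>C \<in> T. frontier C)"

definition tess_algebra :: "'a::euclidean_space set \<Rightarrow> 'a set set measure" where
  "tess_algebra R = sigma tessellations
     {{T \<in> tessellations. tess_boundary T \<inter> C = {}} | C. compact C \<and> C \<subseteq> R}"

definition window :: "'a::euclidean_space set \<Rightarrow> bool" where
  "window W \<longleftrightarrow> polytope W \<and> interior W \<noteq> {}"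

definition window_exhaustion :: "(nat \<Rightarrow> 'a::euclidean_space set) \<Rightarrow> bool" where
  "window_exhaustion W \<longleftrightarrow>
     (\<forall>n. window (W n)) \<and> (\<forall>n. W n \<subseteq> interior (W (Suc n))) \<and> (\<Union>n. W n) = UNIV"

definition tail_algebra :: "(nat \<Rightarrow> 'a::euclidean_space set) \<Rightarrow> 'a set set set set" where
  "tail_algebra W = (\<Inter>n. sets (tess_algebra (- W n)))"

definition poisson_hyperplane_tessellation ::
  "'w measure \<Rightarrow> 'a::euclidean_space set measure \<Rightarrow> ('w \<Rightarrow> 'a set set) \<Rightarrow> bool" where
  "poisson_hyperplane_tessellation M \<Lambda> Y \<longleftrightarrow>
     prob_space M \<and> Y \<in> measurable M (tess_algebra UNIV) \<and>
     (\<exists>\<Phi>. poisson_process M \<Lambda> \<Phi> \<and> (AE \<omega> in M. tess_boundary (Y \<omega>) = \<Union>(\<Phi> \<omega>)))"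

end

theory Submission
  imports Defs
begin

text \<open>Almost surely a hyperplane belongs to the Poisson process iff its trace far away from the origin
  is covered by the boundary of the tessellation: the process is countable, and by Baire's theorem
  a relatively open piece of a hyperplane is not covered by countably many other hyperplanes. In
  dimension at least 2 a hyperplane leaves every window, so the event that the process hits a fixed
  ball is, up to a null set, a tail event. Its probability is \<open>1 - exp (- c)\<close>, where \<open>c\<close> is the
  intensity of hyperplanes hitting the ball, and \<open>0 < c < \<infinity>\<close> for a large ball.\<close>

section \<open>Hyperplanes\<close>

lemma hyperplane_normal_form:
  assumes "H \<in> hyperplanes"
  obtains a b where "norm a = 1" "H = {x. a \<bullet> x = b}"
proof -
  obtain a b where a: "a \<noteq> 0" "H = {x. a \<bullet> x = b}"
    using assms unfolding hyperplanes_def by auto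
  have "H = {x. (a /\<^sub>R norm a) \<bullet> x = b / norm a}"
    using a by (auto simp: field_simps)
  moreover have "norm (a /\<^sub>R norm a) = 1" using a by simp
  ultimately show ?thesis using that by blast
qed

text \<open>With a unit normal, the absolute value of \<open>b\<close> is the distance of the
  hyperplane from the origin, attained at \<open>b *\<^sub>R a\<close>.\<close>

lemma hitting_cball_iff:
  fixes a :: "'a::euclidean_space"
  assumes "norm a = 1"
  shows "{x. a \<bullet> x = b} \<in> hitting (cball 0 R) \<longleftrightarrow> \<bar>b\<bar> \<le> R"
proof
  assume "{x. a \<bullet> x = b} \<in> hitting (cball 0 R)"
  then have "\<exists>x. a \<bullet> x = b \<and> norm x \<le> R" by (auto simp: hitting_def)
  then obtain x where x: "a \<bullet> x = b" "norm x \<le> R" by blast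
  have "\<bar>a \<bullet> x\<bar> \<le> norm a * norm x" by (rule Cauchy_Schwarz_ineq2)
  then show "\<bar>b\<bar> \<le> R" using x assms by simp
next
  assume b: "\<bar>b\<bar> \<le> R"
  have "a \<bullet> a = 1" using assms by (simp add: norm_eq_1)
  then have "b *\<^sub>R a \<in> {x. a \<bullet> x = b} \<inter> cball 0 R" using b assms by simp
  moreover have "{x. a \<bullet> x = b} \<in> hyperplanes"
    using assms unfolding hyperplanes_def by (metis (mono_tags, lifting) mem_Collect_eq norm_zero zero_neq_one)
  ultimately show "{x. a \<bullet> x = b} \<in> hitting (cball 0 R)" unfolding hitting_def by blast
qed

text \<open>In dimension at least 2 one can leave the foot \<open>b *\<^sub>R a\<close> of the
  perpendicular along a unit vector orthogonal to \<open>a\<close>, staying inside the hyperplane,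
  until the norm is \<open>r + 1/2\<close>, halfway through the annulus.\<close>

lemma hyperplane_meets_annulus:
  fixes a :: "'a::euclidean_space"
  assumes "DIM('a) \<ge> 2" "norm a = 1" "\<bar>b\<bar> \<le> r"
  shows "\<exists>x. a \<bullet> x = b \<and> r < norm x \<and> norm x < r + 1"
proof -
  obtain u :: 'a where u: "u \<noteq> 0" "orthogonal a u"
    using orthogonal_to_vector_exists[OF assms(1)] by blast
  define v where "v = u /\<^sub>R norm u"
  have v: "norm v = 1" "a \<bullet> v = 0" using u by (auto simp: v_def orthogonal_def)
  have aa: "a \<bullet> a = 1" "v \<bullet> v = 1" using assms v by (auto simp: norm_eq_1)
  define s where "s = r + 1/2"
  define x where "x = b *\<^sub>R a + sqrt (s\<^sup>2 - b\<^sup>2) *\<^sub>R v"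
  have "\<bar>b\<bar>^2 \<le> s^2" using assms(3) by (intro power_mono) (auto simp: s_def)
  then have bs: "s\<^sup>2 - b\<^sup>2 \<ge> 0" by simp
  have "x \<bullet> x = b * b + sqrt (s\<^sup>2 - b\<^sup>2) * sqrt (s\<^sup>2 - b\<^sup>2)"
    using v(2) aa by (simp add: x_def inner_add_left inner_add_right inner_commute)
  also have "\<dots> = s\<^sup>2" using bs by (simp add: power2_eq_square)
  finally have "norm x = s" using assms(3) by (simp add: norm_eq_sqrt_inner s_def)
  moreover have "a \<bullet> x = b" using v aa by (simp add: x_def inner_add_right)
  ultimately show ?thesis by (intro exI[of _ x]) (simp add: s_def)
qed

text \<open>Distinct hyperplanes have equal dimension, so neither contains the other, and removing
  \<open>K\<close> from \<open>H\<close> leaves a relatively open dense subset of \<open>H\<close>.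
  By Baire's theorem countably many such removals still leave a point of \<open>H\<close> in
  \<open>A\<close>.\<close>

lemma hyperplane_covered_by_countable:
  fixes H :: "'a::euclidean_space set"
  assumes H: "H \<in> hyperplanes" and \<F>: "countable \<F>" "\<F> \<subseteq> hyperplanes"
    and A: "open A" "H \<inter> A \<noteq> {}" "H \<inter> A \<subseteq> \<Union>\<F>"
  shows "H \<in> \<F>"
proof (rule ccontr)
  assume "H \<notin> \<F>"
  have plane: "closed K \<and> affine K \<and> aff_dim K = DIM('a) - 1" if K: "K \<in> hyperplanes" for K :: "'a set"
    using K unfolding hyperplanes_def
    by (auto simp: closed_hyperplane affine_hyperplane aff_dim_hyperplane)
  have dense: "openin (top_of_set H) (H - K) \<and> H \<subseteq> closure (H - K)" if K: "K \<in> \<F>" for K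
  proof
    have KH: "K \<in> hyperplanes" using K \<F> by blast
    show "openin (top_of_set H) (H - K)"
      using plane[OF KH] by (metis Diff_eq open_Compl openin_open_Int)
    have "\<not> H \<subseteq> K"
    proof
      assume sub: "H \<subseteq> K"
      have "H \<noteq> {}" using A(2) by blast
      then have "H = K"
        using affine_dim_equal[OF _ _ _ sub] plane[OF KH] plane[OF H] by presburger
      then show False using K \<open>H \<notin> \<F>\<close> by simp
    qed
    then obtain q where q: "q \<in> H" "q \<notin> K" by blast
    show "H \<subseteq> closure (H - K)"
    proof
      fix x assume x: "x \<in> H"
      \<comment> \<open>If \<open>x\<close> is in \<open>K\<close>, the line from \<open>x\<close>
        to \<open>q\<close>, which stays in \<open>H\<close>, meets \<open>K\<close> only at
        \<open>x\<close>, because \<open>q\<close> is off \<open>K\<close>. Its points with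
        \<open>t = 1 / Suc n\<close> approach \<open>x\<close>.\<close>
      define y where "y t = (1 - t) *\<^sub>R x + t *\<^sub>R q" for t :: real
      show "x \<in> closure (H - K)"
      proof (cases "x \<in> K")
        case False
        then have "x \<in> H - K" using x by simp
        then show ?thesis by (rule subsetD[OF closure_subset])
      next
        case True
        have yH: "y t \<in> H" for t
          using plane[OF H] x q by (auto simp: y_def affine_alt)
        have yK: "y t \<notin> K" if "t \<noteq> 0" for t
        proof
          assume "y t \<in> K"
          then have "(1 - 1/t) *\<^sub>R x + (1/t) *\<^sub>R y t \<in> K"
            using plane[OF KH] True by (auto simp: affine_alt)
          moreover have "(1 - 1/t) *\<^sub>R x + (1/t) *\<^sub>R y t = q"
            using that by (simp add: y_def algebra_simps)
          ultimately show False using q by simp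
        qed
        have "(\<lambda>n. y (1 / real (Suc n))) \<longlonglongrightarrow> (1 - 0) *\<^sub>R x + 0 *\<^sub>R q"
          unfolding y_def by (intro tendsto_intros LIMSEQ_Suc[OF lim_1_over_n])
        then show ?thesis
          unfolding closure_sequential using yH yK
          by (intro exI[of _ "\<lambda>n. y (1 / real (Suc n))"]) auto
      qed
    qed
  qed
  \<comment> \<open>The extra member \<open>H - {}\<close> is \<open>H\<close> itself; it keeps the
    intersection inside \<open>H\<close> even for an empty family.\<close>
  have "H \<subseteq> closure (\<Inter>((\<lambda>K. H - K) ` insert {} \<F>))"
    using plane[OF H] dense \<F>(1) closure_subset[of H] by (intro Baire) auto
  moreover obtain p where "p \<in> H" "p \<in> A" using A(2) by blast
  ultimately have "A \<inter> closure (\<Inter>((\<lambda>K. H - K) ` insert {} \<F>)) \<noteq> {}" by blast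
  then have "A \<inter> \<Inter>((\<lambda>K. H - K) ` insert {} \<F>) \<noteq> {}"
    using open_Int_closure_eq_empty[OF A(1)] by metis
  then show False using A(3) by blast
qed

section \<open>The Fell topology and its Borel sets\<close>

lemma topspace_hyperplane_topology: "topspace hyperplane_topology = hyperplanes"
proof -
  let ?B = "{hyperplanes - hitting C | C. compact C} \<union> {hitting G | G. open G} :: 'a set set set"
  have "hyperplanes - hitting {} \<in> ?B" using compact_empty by blast
  moreover have "hyperplanes - hitting {} = (hyperplanes :: 'a set set)" by (simp add: hitting_def)
  ultimately have "hyperplanes \<in> ?B" by (rule back_subst[of "\<lambda>S. S \<in> ?B"])
  then have "hyperplanes \<subseteq> \<Union>?B" by (rule Union_upper)
  moreover have "U \<subseteq> hyperplanes" if "U \<in> ?B" for U using that by (auto simp: hitting_def)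
  then have "\<Union>?B \<subseteq> hyperplanes" by (rule Union_least)
  ultimately show ?thesis
    unfolding hyperplane_topology_def topology_generated_by_topspace by (rule subset_antisym[rotated])
qed

lemma space_hyperplane_borel: "space hyperplane_borel = hyperplanes"
  unfolding hyperplane_borel_def
  by (rule space_measure_of) (use openin_subset topspace_hyperplane_topology in blast)

text \<open>The complement of \<open>hitting C\<close> is one of the generating open sets of the
  Fell topology.\<close>

lemma hitting_compact_measurable:
  assumes "compact C"
  shows "hitting C \<in> sets hyperplane_borel"
proof -
  have sub: "{U. openin hyperplane_topology U} \<subseteq> Pow hyperplanes"
    using openin_subset topspace_hyperplane_topology by blast
  have "openin hyperplane_topology (hyperplanes - hitting C)"
    unfolding hyperplane_topology_def using assms by (intro topology_generated_by_Basis) auto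
  then have "hyperplanes - hitting C \<in> sets hyperplane_borel"
    unfolding hyperplane_borel_def using sub by (intro in_measure_of) auto
  then have "space hyperplane_borel - (hyperplanes - hitting C) \<in> sets hyperplane_borel"
    by (rule sets.compl_sets)
  moreover have "hyperplanes - (hyperplanes - hitting C) = hitting C"
    by (auto simp: hitting_def)
  ultimately show ?thesis by (simp add: space_hyperplane_borel)
qed

section \<open>Tessellations\<close>

text \<open>By local finiteness only finitely many cells meet a unit ball, so near each point the
  boundary is covered by a finite union of closed frontiers.\<close>

lemma closed_tess_boundary:
  assumes "T \<in> tessellations"
  shows "closed (tess_boundary T)"
proof -
  have "x \<in> tess_boundary T" if x: "x \<in> closure (tess_boundary T)" for x
  proof -
    define \<C> where "\<C> = {C \<in> T. C \<inter> ball x 1 \<noteq> {}}"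
    have fin: "finite \<C>" using assms bounded_ball unfolding tessellations_def \<C>_def by blast
    have "ball x 1 \<inter> tess_boundary T \<subseteq> (\<Union>C\<in>\<C>. frontier C)"
    proof
      fix y assume y: "y \<in> ball x 1 \<inter> tess_boundary T"
      then obtain C where C: "C \<in> T" "y \<in> frontier C" by (auto simp: tess_boundary_def)
      then have "closed C" using assms unfolding tessellations_def by (auto intro: polytope_imp_closed)
      then have "y \<in> C" using C frontier_subset_closed by blast
      then have "C \<in> \<C>" using C(1) y unfolding \<C>_def by blast
      then show "y \<in> (\<Union>C\<in>\<C>. frontier C)" using C(2) by blast
    qed
    moreover have "closed (\<Union>C\<in>\<C>. frontier C)" using fin by (intro closed_UN) auto
    ultimately have "closure (ball x 1 \<inter> tess_boundary T) \<subseteq> (\<Union>C\<in>\<C>. frontier C)"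
      by (rule closure_minimal)
    moreover have "x \<in> closure (ball x 1 \<inter> tess_boundary T)"
      using open_Int_closure_subset[of "ball x 1" "tess_boundary T"] x by auto
    ultimately show ?thesis by (auto simp: tess_boundary_def \<C>_def)
  qed
  then show ?thesis by (metis closure_subset_eq subsetI)
qed

section \<open>Measurable events and tail events of tessellations\<close>

lemma space_tess_algebra: "space (tess_algebra R) = tessellations"
  unfolding tess_algebra_def by (rule space_measure_of) auto

lemma tess_algebra_mono: "R \<subseteq> S \<Longrightarrow> sets (tess_algebra R) \<subseteq> sets (tess_algebra S)"
  unfolding tess_algebra_def
  by (subst (1 2) sets_measure_of) (auto intro!: sigma_sets_mono')

lemma hit_tess_boundary_measurable:
  assumes "compact C" "C \<subseteq> R"
  shows "{T \<in> space (tess_algebra R). tess_boundary T \<inter> C \<noteq> {}} \<in> sets (tess_algebra R)"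
proof -
  have "{T \<in> tessellations. tess_boundary T \<inter> C = {}} \<in> sets (tess_algebra R)"
    unfolding tess_algebra_def using assms by (intro in_measure_of) auto
  then have "space (tess_algebra R) - {T \<in> tessellations. tess_boundary T \<inter> C = {}} \<in> sets (tess_algebra R)"
    by (rule sets.compl_sets)
  also have "space (tess_algebra R) - {T \<in> tessellations. tess_boundary T \<inter> C = {}}
      = {T \<in> space (tess_algebra R). tess_boundary T \<inter> C \<noteq> {}}"
    by (auto simp: space_tess_algebra)
  finally show ?thesis .
qed

text \<open>The pairs \<open>(a, b)\<close> form a compact parameter set for the hyperplanes hitting
  the closed ball of radius \<open>R\<close>. The inclusion is vacuous for a hyperplane that misses
  \<open>A\<close>, so the event is informative when \<open>A\<close> meets all of them, as an
  annulus outside that ball does in dimension at least 2.\<close>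

definition trace_event :: "real \<Rightarrow> 'a::euclidean_space set \<Rightarrow> 'a set set set" where
  "trace_event R A = {T \<in> tessellations.
     \<exists>a b. norm a = 1 \<and> \<bar>b\<bar> \<le> R \<and> {x \<in> A. a \<bullet> x = b} \<subseteq> tess_boundary T}"

text \<open>Expresses the existence of a hyperplane whose trace in \<open>A\<close> lies in \<open>F\<close> by countably many
  conditions of the form that \<open>F\<close> hits a compact ball inside \<open>A\<close>. The point at distance
  \<open>\<bar>a \<bullet> x - b\<bar>\<close> from \<open>x\<close> that makes the balls hit is the projection of \<open>x\<close> to the hyperplane.\<close>

lemma trace_in_closed_iff:
  fixes A F :: "'a::euclidean_space set" and R :: real
  defines "P \<equiv> sphere 0 1 \<times> {-R..R}"
  assumes F: "closed F" and A: "open A" "bounded A"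
    and Q: "Q \<subseteq> A" "A \<subseteq> closure Q" and P': "P' \<subseteq> P" "P \<subseteq> closure P'"
  shows "(\<exists>a b. norm a = 1 \<and> \<bar>b\<bar> \<le> R \<and> {x \<in> A. a \<bullet> x = b} \<subseteq> F) \<longleftrightarrow>
    (\<forall>k::nat. \<exists>p\<in>P'. \<forall>x\<in>Q. cball x (\<bar>fst p \<bullet> x - snd p\<bar> + 1 / Suc k) \<subseteq> A \<longrightarrow>
        F \<inter> cball x (\<bar>fst p \<bullet> x - snd p\<bar> + 1 / Suc k) \<noteq> {})"
    (is "?L \<longleftrightarrow> ?R")
proof
  assume ?L
  then obtain a b where ab: "norm a = 1" "\<bar>b\<bar> \<le> R" "{x \<in> A. a \<bullet> x = b} \<subseteq> F" by blast
  obtain B where B: "B > 0" "\<And>x. x \<in> A \<Longrightarrow> norm x \<le> B"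
    using A(2) bounded_pos by blast
  show ?R
  proof
    fix k :: nat
    \<comment> \<open>For \<open>x\<close> in \<open>A\<close>, moving \<open>(a, b)\<close> by less
      than \<open>e\<close> changes \<open>a \<bullet> x - b\<close> by at most
      \<open>e * B + e\<close>, which is exactly the slack \<open>1 / Suc k\<close> in the
      radius.\<close>
    define e where "e = 1 / (real (Suc k) * (B + 1))"
    have e: "e > 0" "e * (B + 1) = 1 / Suc k" using B by (auto simp: e_def)
    have "(a, b) \<in> P" using ab by (auto simp: P_def)
    then have "(a, b) \<in> closure P'" using P'(2) by blast
    then obtain a' b' where p: "(a', b') \<in> P'" "dist (a', b') (a, b) < e"
      using e(1) by (metis closure_approachable surj_pair)
    have d: "dist a' a < e" "dist b' b < e"
      using p(2) dist_fst_le[of "(a', b')" "(a, b)"] dist_snd_le[of "(a', b')" "(a, b)"] by auto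
    show "\<exists>p\<in>P'. \<forall>x\<in>Q. cball x (\<bar>fst p \<bullet> x - snd p\<bar> + 1 / Suc k) \<subseteq> A \<longrightarrow>
        F \<inter> cball x (\<bar>fst p \<bullet> x - snd p\<bar> + 1 / Suc k) \<noteq> {}"
    proof (intro bexI[OF _ p(1)] ballI impI, unfold fst_conv snd_conv)
      fix x assume x: "x \<in> Q" and sub: "cball x (\<bar>a' \<bullet> x - b'\<bar> + 1 / Suc k) \<subseteq> A"
      have "\<bar>(a - a') \<bullet> x\<bar> \<le> norm (a - a') * norm x" by (rule Cauchy_Schwarz_ineq2)
      also have "\<dots> \<le> e * B"
        using d(1) B(2)[of x] x Q(1) e(1) by (intro mult_mono) (auto simp: dist_norm norm_minus_commute)
      finally have "\<bar>a \<bullet> x - a' \<bullet> x\<bar> \<le> e * B" by (simp add: inner_diff_left)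
      then have le: "\<bar>a \<bullet> x - b\<bar> \<le> \<bar>a' \<bullet> x - b'\<bar> + 1 / Suc k"
        using d(2) e(2) by (simp add: dist_real_def distrib_left)
      define y where "y = x - (a \<bullet> x - b) *\<^sub>R a"
      have "a \<bullet> a = 1" using ab(1) by (simp add: norm_eq_1)
      then have "a \<bullet> y = b" by (simp add: y_def inner_diff_right)
      moreover have y: "y \<in> cball x (\<bar>a' \<bullet> x - b'\<bar> + 1 / Suc k)"
        using le ab(1) by (simp add: y_def dist_norm)
      ultimately have "y \<in> F" using sub ab(3) by blast
      then show "F \<inter> cball x (\<bar>a' \<bullet> x - b'\<bar> + 1 / Suc k) \<noteq> {}" using y by blast
    qed
  qed
next
  assume ?R
  then obtain p where p: "\<And>k. p k \<in> P'"
    "\<And>k x. x \<in> Q \<Longrightarrow> cball x (\<bar>fst (p k) \<bullet> x - snd (p k)\<bar> + 1 / real (Suc k)) \<subseteq> A \<Longrightarrow>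
        F \<inter> cball x (\<bar>fst (p k) \<bullet> x - snd (p k)\<bar> + 1 / Suc k) \<noteq> {}"
    by metis
  \<comment> \<open>Each \<open>k\<close> yields only an approximate hyperplane. Compactness of the
    parameter set supplies a limit \<open>l\<close>, whose hyperplane has its trace in
    \<open>F\<close>.\<close>
  have "compact P" unfolding P_def by (intro compact_Times) auto
  then have "seq_compact P" by (simp add: compact_eq_seq_compact_metric)
  then obtain l \<phi> where l: "l \<in> P" "strict_mono \<phi>" "(p \<circ> \<phi>) \<longlonglongrightarrow> l"
    unfolding seq_compact_def using p(1) P'(1) by (metis subsetD)
  obtain a b where ab: "l = (a, b)" by (cases l)
  have "x \<in> F" if x: "x \<in> A" "a \<bullet> x = b" for x
  proof -
    obtain e0 where e0: "e0 > 0" "cball x e0 \<subseteq> A" using A(1) x(1) open_contains_cball by blast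
    have "\<exists>y\<in>F. dist y x < e" if e: "e > 0" for e
    proof -
      \<comment> \<open>The ball around \<open>q\<close> will have radius below
        \<open>2 * d\<close>, with \<open>q\<close> within \<open>d\<close> of \<open>x\<close>.
        Hence its points are within \<open>3 * d\<close> of \<open>x\<close>, which is less than
        both \<open>e\<close> and \<open>e0\<close>.\<close>
      define d where "d = min e e0 / 4"
      have d: "d > 0" "4 * d \<le> e" "4 * d \<le> e0" using e e0 by (auto simp: d_def)
      \<comment> \<open>Since \<open>x\<close> lies on the limit hyperplane, the radii prescribed at
        \<open>x\<close> tend to 0.\<close>
      have "(\<lambda>n. \<bar>fst ((p \<circ> \<phi>) n) \<bullet> x - snd ((p \<circ> \<phi>) n)\<bar> + 1 / real (Suc (\<phi> n))) \<longlonglongrightarrow>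
          \<bar>fst l \<bullet> x - snd l\<bar> + 0"
        by (intro tendsto_intros l(3) LIMSEQ_subseq_LIMSEQ[OF LIMSEQ_Suc[OF lim_1_over_n] l(2), unfolded o_def])
      then have "(\<lambda>n. \<bar>fst (p (\<phi> n)) \<bullet> x - snd (p (\<phi> n))\<bar> + 1 / real (Suc (\<phi> n))) \<longlonglongrightarrow> 0"
        using x(2) ab by simp
      then obtain n where n: "\<bar>fst (p (\<phi> n)) \<bullet> x - snd (p (\<phi> n))\<bar> + 1 / real (Suc (\<phi> n)) < d"
        using order_tendstoD(2)[OF _ d(1)] eventually_sequentially by (metis (mono_tags, lifting) le_refl)
      define a' b' where "a' = fst (p (\<phi> n))" and "b' = snd (p (\<phi> n))"
      have a': "norm a' = 1" using p(1)[of "\<phi> n"] P'(1) by (auto simp: P_def a'_def)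
      obtain q where q: "q \<in> Q" "dist q x < d"
        using x(1) Q(2) d(1) by (meson closure_approachable subsetD)
      have "\<bar>a' \<bullet> (q - x)\<bar> \<le> norm a' * norm (q - x)" by (rule Cauchy_Schwarz_ineq2)
      also have "\<dots> < d" using a' q(2) by (simp add: dist_norm)
      finally have "\<bar>a' \<bullet> q - a' \<bullet> x\<bar> < d" by (simp add: inner_diff_right)
      then have s: "\<bar>a' \<bullet> q - b'\<bar> + 1 / real (Suc (\<phi> n)) < 2 * d"
        using n by (simp add: a'_def b'_def)
      have "cball q (\<bar>a' \<bullet> q - b'\<bar> + 1 / real (Suc (\<phi> n))) \<subseteq> cball x e0"
      proof
        fix z assume "z \<in> cball q (\<bar>a' \<bullet> q - b'\<bar> + 1 / real (Suc (\<phi> n)))"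
        then have "dist q z < 2 * d" using s by simp
        then show "z \<in> cball x e0" using q(2) d dist_triangle[of x z q] by (simp add: dist_commute)
      qed
      then have "F \<inter> cball q (\<bar>a' \<bullet> q - b'\<bar> + 1 / real (Suc (\<phi> n))) \<noteq> {}"
        using p(2)[OF q(1), of "\<phi> n"] e0(2) unfolding a'_def b'_def by blast
      then obtain y where y: "y \<in> F" "dist q y < 2 * d" using s by fastforce
      then have "dist y x < e" using q(2) d dist_triangle[of y x q] by (simp add: dist_commute)
      then show ?thesis using y(1) by blast
    qed
    then show ?thesis using F closed_approachable by blast
  qed
  then show ?L using l(1) ab by (intro exI[of _ a] exI[of _ b]) (auto simp: P_def)
qed

text \<open>Countable dense sets of centres and of parameters turn the ball criterion into a
  countable combination of events that the boundary hits a compact ball inside \<open>A\<close>,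
  hence inside \<open>S\<close>.\<close>

lemma trace_event_measurable:
  fixes A :: "'a::euclidean_space set"
  assumes A: "open A" "bounded A" "A \<subseteq> S"
  shows "trace_event R A \<in> sets (tess_algebra S)"
proof -
  obtain Q where Q: "countable Q" "Q \<subseteq> A" "A \<subseteq> closure Q" using separable .
  obtain P' where P': "countable P'" "P' \<subseteq> sphere 0 1 \<times> {-R..R}"
      "(sphere 0 1 :: 'a set) \<times> {-R..R} \<subseteq> closure P'"
    using separable .
  have hit: "{T \<in> space (tess_algebra S). cball x s \<subseteq> A \<longrightarrow> tess_boundary T \<inter> cball x s \<noteq> {}}
      \<in> sets (tess_algebra S)" for x s
  proof (cases "cball x s \<subseteq> A")
    case True
    then show ?thesis
      using hit_tess_boundary_measurable[of "cball x s" S] A(3) by auto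
  qed simp
  have "trace_event R A = {T \<in> space (tess_algebra S). \<forall>k::nat. \<exists>p\<in>P'. \<forall>x\<in>Q.
      cball x (\<bar>fst p \<bullet> x - snd p\<bar> + 1 / Suc k) \<subseteq> A \<longrightarrow>
        tess_boundary T \<inter> cball x (\<bar>fst p \<bullet> x - snd p\<bar> + 1 / Suc k) \<noteq> {}}"
    using trace_in_closed_iff[OF closed_tess_boundary A(1,2) Q(2,3) P'(2,3)]
    unfolding trace_event_def space_tess_algebra by blast
  also have "\<dots> \<in> sets (tess_algebra S)"
    by (intro sets.sets_Collect_countable_All sets.sets_Collect_countable_Ex'
        sets.sets_Collect_countable_All' hit P'(1) Q(1))
  finally show ?thesis .
qed

text \<open>A limit superior ignores the indices below \<open>k\<close>, and for
  \<open>n \<ge> k\<close> the set \<open>A n\<close> avoids \<open>W k\<close> because the windows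
  increase.\<close>

lemma limsup_trace_event_tail:
  fixes W A :: "nat \<Rightarrow> 'a::euclidean_space set"
  assumes W: "\<And>n. W n \<subseteq> W (Suc n)"
    and A: "\<And>n. open (A n)" "\<And>n. bounded (A n)" "\<And>n. A n \<inter> W n = {}"
  shows "(\<Inter>m. \<Union>n\<in>{m..}. trace_event R (A n)) \<in> tail_algebra W"
  unfolding tail_algebra_def
proof (rule INT_I)
  fix k
  have "(\<Inter>m. \<Union>n\<in>{m..}. trace_event R (A n)) = (\<Inter>m. \<Union>n\<in>{max k m..}. trace_event R (A n))"
    (is "?l = ?r")
  proof
    show "?l \<subseteq> ?r" by blast
    show "?r \<subseteq> ?l" by fastforce
  qed
  also have "\<dots> \<in> sets (tess_algebra (- W k))"
  proof -
    have "trace_event R (A n) \<in> sets (tess_algebra (- W k))" if "k \<le> n" for n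
    proof (intro trace_event_measurable A)
      have "W k \<subseteq> W n" using lift_Suc_mono_le[of W, OF W that] .
      then show "A n \<subseteq> - W k" using A(3)[of n] by blast
    qed
    then have "(\<Union>n\<in>{max k m..}. trace_event R (A n)) \<in> sets (tess_algebra (- W k))" for m
      by (intro sets.countable_UN') auto
    then show ?thesis by (intro sets.countable_INT) auto
  qed
  finally show "?l \<in> sets (tess_algebra (- W k))" .
qed

section \<open>Poisson processes\<close>

text \<open>The Poisson probabilities sum to 1 by the exponential series, so the number of points is
  almost surely a natural number.\<close>

lemma poisson_process_finite:
  assumes "poisson_process M \<Lambda> \<Phi>" "A \<in> sets \<Lambda>" "emeasure \<Lambda> A < \<infinity>"
  shows "AE \<omega> in M. finite (\<Phi> \<omega> \<inter> A)"
proof -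
  interpret prob_space M using assms(1) by (simp add: poisson_process_def)
  have meas[measurable]: "npoints \<Phi> A \<in> borel_measurable M"
    using assms by (auto simp: poisson_process_def)
  define E where "E k = {\<omega> \<in> space M. npoints \<Phi> A \<omega> = of_nat k}" for k :: nat
  have E: "range E \<subseteq> events" unfolding E_def by auto
  have "(\<lambda>k. exp (- measure \<Lambda> A) * (measure \<Lambda> A ^ k /\<^sub>R fact k)) sums
      (exp (- measure \<Lambda> A) * exp (measure \<Lambda> A))"
    by (intro sums_mult exp_converges)
  moreover have "prob (E k) = exp (- measure \<Lambda> A) * (measure \<Lambda> A ^ k /\<^sub>R fact k)" for k
    using assms by (simp add: poisson_process_def E_def field_simps)
  ultimately have "(\<lambda>k. prob (E k)) sums 1" by (simp add: exp_minus)
  moreover have "disjoint_family E" by (auto simp: disjoint_family_on_def E_def)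
  then have "(\<lambda>k. prob (E k)) sums prob (\<Union>k. E k)" by (rule finite_measure_UNION[OF E])
  ultimately have "prob (\<Union>k. E k) = 1" using sums_unique2 by blast
  then have "AE \<omega> in M. \<omega> \<in> (\<Union>k. E k)" using E by (intro AE_prob_1)
  then show ?thesis
  proof eventually_elim
    case (elim \<omega>)
    then obtain k where "npoints \<Phi> A \<omega> = of_nat k" by (auto simp: E_def)
    then have "npoints \<Phi> A \<omega> \<noteq> \<infinity>" by (metis ennreal_of_nat_neq_top infinity_ennreal_def)
    then show ?case unfolding npoints_def by (metis emeasure_count_space_infinite top_greatest infinity_ennreal_def)
  qed
qed

text \<open>Balls of integer radius exhaust the space, so every hyperplane hits one of them; if all
  these hitting sets were null, so would be their countable union.\<close>

lemma emeasure_hitting_cball_pos: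
  fixes \<Lambda> :: "'a::euclidean_space set measure"
  assumes "sets \<Lambda> = sets hyperplane_borel" "emeasure \<Lambda> (space \<Lambda>) \<noteq> 0"
  shows "\<exists>n::nat. emeasure \<Lambda> (hitting (cball 0 (real n))) > 0"
proof (rule ccontr)
  assume "\<not> ?thesis"
  then have "emeasure \<Lambda> (\<Union>n. hitting (cball 0 (real n))) = 0"
    using hitting_compact_measurable[OF compact_cball] assms(1)
    by (intro emeasure_UN_eq_0) auto
  moreover have "(\<Union>n. hitting (cball 0 (real n))) = space \<Lambda>"
  proof -
    have "H \<in> (\<Union>n. hitting (cball 0 (real n)))" if "H \<in> hyperplanes" for H :: "'a set"
    proof -
      obtain a b where ab: "norm a = 1" "H = {x. a \<bullet> x = b}"
        using hyperplane_normal_form[OF \<open>H \<in> hyperplanes\<close>] by blast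
      obtain n :: nat where "\<bar>b\<bar> \<le> real n" using real_arch_simple by blast
      then show ?thesis using ab hitting_cball_iff by blast
    qed
    moreover have "space \<Lambda> = hyperplanes"
      using sets_eq_imp_space_eq[OF assms(1)] space_hyperplane_borel by simp
    ultimately show ?thesis by (auto simp: hitting_def)
  qed
  ultimately show False using assms(2) by simp
qed

section \<open>Construction of a non-trivial tail event\<close>

theorem lemma8:
  fixes \<Lambda> :: "'a::euclidean_space set measure"
    and M :: "'w measure"
    and Y :: "'w \<Rightarrow> 'a set set"
    and W :: "nat \<Rightarrow> 'a set"
  assumes "sets \<Lambda> = sets hyperplane_borel"
    and "emeasure \<Lambda> (space \<Lambda>) \<noteq> 0"
    and "locally_finite_measure \<Lambda>"
    and "translation_invariant \<Lambda>"
    and "\<not> (\<exists>L. is_line L \<and> (\<forall>H \<in> measure_support \<Lambda>. parallel_flats H L))"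
    and "poisson_hyperplane_tessellation M \<Lambda> Y"
    and "window_exhaustion W"
  shows "\<exists>D \<in> tail_algebra W. 0 < \<P>(\<omega> in M. Y \<omega> \<in> D) \<and> \<P>(\<omega> in M. Y \<omega> \<in> D) < 1"
proof -
  \<comment> \<open>In dimension 1 the whole space is a line to which every hyperplane is parallel,
    contrary to the assumption on the support.\<close>
  have dim: "DIM('a) \<ge> 2"
  proof (rule ccontr)
    assume "\<not> DIM('a) \<ge> 2"
    moreover have "DIM('a) > 0" by (rule DIM_positive)
    ultimately have "DIM('a) = 1" by linarith
    then have "is_line (UNIV :: 'a set)" by (simp add: is_line_def aff_dim_UNIV)
    then show False using assms(5) by (auto simp: parallel_flats_def)
  qed
  interpret prob_space M using assms(6) by (simp add: poisson_hyperplane_tessellation_def)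
  obtain \<Phi> where Y[measurable]: "Y \<in> measurable M (tess_algebra UNIV)"
    and \<Phi>: "poisson_process M \<Lambda> \<Phi>"
    and Y\<Phi>: "AE \<omega> in M. tess_boundary (Y \<omega>) = \<Union>(\<Phi> \<omega>)"
    using assms(6) by (auto simp: poisson_hyperplane_tessellation_def)
  have space: "space \<Lambda> = hyperplanes"
    using sets_eq_imp_space_eq[OF assms(1)] space_hyperplane_borel by simp
  have hit: "hitting (cball 0 r) \<in> sets \<Lambda>" "emeasure \<Lambda> (hitting (cball 0 r)) < \<infinity>" for r
    using assms(1,3) hitting_compact_measurable[OF compact_cball]
    by (auto simp: locally_finite_measure_def)
  obtain R :: nat where R: "emeasure \<Lambda> (hitting (cball 0 (real R))) > 0"
    using emeasure_hitting_cball_pos[OF assms(1,2)] by blast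
  \<comment> \<open>Beyond radius \<open>r\<close> lies no point of the window, and
    \<open>real R \<le> r\<close> lets every hyperplane hitting the ball of radius \<open>R\<close>
    meet the annulus just outside radius \<open>r\<close>.\<close>
  have "\<exists>r. real R \<le> r \<and> W n \<subseteq> cball 0 r" for n
  proof -
    have "bounded (W n)"
      using assms(7) by (auto simp: window_exhaustion_def window_def polytope_imp_bounded)
    then obtain r where "\<forall>x\<in>W n. norm x \<le> r" using bounded_iff by blast
    then show ?thesis by (intro exI[of _ "max r (real R)"]) auto
  qed
  then obtain r where r: "\<And>n. real R \<le> r n" "\<And>n. W n \<subseteq> cball 0 (r n)" by metis
  define A :: "nat \<Rightarrow> 'a set" where "A n = ball 0 (r n + 1) - cball 0 (r n)" for n
  have A: "open (A n)" "bounded (A n)" "A n \<inter> W n = {}" for n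
    using r(2)[of n] by (auto simp: A_def intro!: bounded_diff)
  \<comment> \<open>Each trace event alone sees only the complement of one window; the limit
    superior makes the event measurable outside every window.\<close>
  define D where "D = (\<Inter>m. \<Union>n\<in>{m..}. trace_event (real R) (A n))"
  have "W n \<subseteq> W (Suc n)" for n
    using assms(7) interior_subset unfolding window_exhaustion_def by blast
  then have D: "D \<in> tail_algebra W"
    unfolding D_def by (rule limsup_trace_event_tail) (rule A)+
  then have D_meas[measurable]: "D \<in> sets (tess_algebra UNIV)"
    using tess_algebra_mono[of "- W 0" UNIV] by (auto simp: tail_algebra_def)

  define N where "N = npoints \<Phi> (hitting (cball 0 (real R)))"
  have N[measurable]: "N \<in> borel_measurable M"
    using \<Phi> hit by (auto simp: poisson_process_def N_def)
  \<comment> \<open>Finiteness in all integer balls simultaneously makes the whole process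
    countable, as the covering argument requires.\<close>
  have "AE \<omega> in M. \<forall>n::nat. finite (\<Phi> \<omega> \<inter> hitting (cball 0 (real n)))"
    unfolding AE_all_countable using poisson_process_finite[OF \<Phi> hit] by blast
  with Y\<Phi> AE_space have ae: "AE \<omega> in M. Y \<omega> \<in> D \<longleftrightarrow> N \<omega> \<noteq> 0"
  proof eventually_elim
    case (elim \<omega>)
    have \<Phi>sub: "\<Phi> \<omega> \<subseteq> hyperplanes"
      using \<Phi> elim(2) space unfolding poisson_process_def by blast
    have Yt: "Y \<omega> \<in> tessellations"
      using measurable_space[OF Y elim(2)] by (simp add: space_tess_algebra)
    have N0: "N \<omega> \<noteq> 0 \<longleftrightarrow> \<Phi> \<omega> \<inter> hitting (cball 0 (real R)) \<noteq> {}"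
      unfolding N_def npoints_def by (subst emeasure_count_space_eq_0) auto
    show ?case
    proof
      assume "Y \<omega> \<in> D"
      \<comment> \<open>A single annulus already identifies a hyperplane of the process, by the
        covering lemma.\<close>
      then obtain n where "Y \<omega> \<in> trace_event (real R) (A n)" unfolding D_def by blast
      then obtain a b where ab: "norm a = 1" "\<bar>b\<bar> \<le> real R"
          "{x \<in> A n. a \<bullet> x = b} \<subseteq> \<Union>(\<Phi> \<omega>)"
        using elim(1) by (auto simp: trace_event_def)
      have H: "{x. a \<bullet> x = b} \<in> hitting (cball 0 (real R))"
        using ab hitting_cball_iff by blast
      have "\<Phi> \<omega> \<subseteq> (\<Union>n. \<Phi> \<omega> \<inter> hitting (cball 0 (real n)))"
      proof
        fix H assume H: "H \<in> \<Phi> \<omega>"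
        then obtain c d where cd: "norm c = 1" "H = {x. c \<bullet> x = d}"
          using \<Phi>sub hyperplane_normal_form by blast
        obtain n :: nat where "\<bar>d\<bar> \<le> real n" using real_arch_simple by blast
        then show "H \<in> (\<Union>n. \<Phi> \<omega> \<inter> hitting (cball 0 (real n)))"
          using cd H hitting_cball_iff by blast
      qed
      moreover have "countable (\<Union>n. \<Phi> \<omega> \<inter> hitting (cball 0 (real n)))"
        using elim(3) by (intro countable_UN) (auto intro: countable_finite)
      ultimately have "countable (\<Phi> \<omega>)" by (rule countable_subset)
      moreover have "\<bar>b\<bar> \<le> r n" using ab(2) r(1)[of n] by linarith
      then have "{x. a \<bullet> x = b} \<inter> A n \<noteq> {}"
        using hyperplane_meets_annulus[OF dim ab(1), of b "r n"] by (auto simp: A_def)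
      moreover have "{x. a \<bullet> x = b} \<in> hyperplanes" using H by (simp add: hitting_def)
      moreover have "{x. a \<bullet> x = b} \<inter> A n \<subseteq> \<Union>(\<Phi> \<omega>)" using ab(3) by blast
      ultimately have "{x. a \<bullet> x = b} \<in> \<Phi> \<omega>"
        using hyperplane_covered_by_countable \<Phi>sub A(1) by metis
      then show "N \<omega> \<noteq> 0" using H N0 by blast
    next
      assume "N \<omega> \<noteq> 0"
      then obtain H where H: "H \<in> \<Phi> \<omega>" "H \<in> hitting (cball 0 (real R))" using N0 by blast
      then obtain a b where ab: "norm a = 1" "H = {x. a \<bullet> x = b}"
        using \<Phi>sub hyperplane_normal_form by blast
      then have "\<bar>b\<bar> \<le> real R" using H(2) hitting_cball_iff by blast
      \<comment> \<open>The whole of \<open>H\<close> lies in the boundary, so its trace is covered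
        in every annulus, and the trace events occur for all \<open>n\<close>.\<close>
      moreover have "{x \<in> A n. a \<bullet> x = b} \<subseteq> tess_boundary (Y \<omega>)" for n
        using H(1) ab(2) elim(1) by blast
      ultimately have "Y \<omega> \<in> trace_event (real R) (A n)" for n
        using ab(1) Yt unfolding trace_event_def by blast
      then show "Y \<omega> \<in> D" unfolding D_def by blast
    qed
  qed

  \<comment> \<open>The probability of the tail event\<close>
  define c where "c = measure \<Lambda> (hitting (cball 0 (real R)) :: 'a set set)"
  have c: "c > 0" using R hit(2)[of "real R"]
    by (simp add: c_def measure_def enn2real_positive_iff)
  have "\<P>(\<omega> in M. Y \<omega> \<in> D) = \<P>(\<omega> in M. \<not> N \<omega> = 0)"
    using ae by (intro measure_eq_AE) auto
  also have "\<dots> = 1 - \<P>(\<omega> in M. N \<omega> = 0)"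
    by (rule prob_neg) measurable
  \<comment> \<open>The void probability: the instance \<open>k = 0\<close> of the Poisson law, left
    unsimplified to match the definition.\<close>
  also have "\<P>(\<omega> in M. N \<omega> = of_nat 0) = exp (- c) * c ^ 0 / fact 0"
    using \<Phi> hit[of "real R"] unfolding poisson_process_def N_def c_def by blast
  then have "\<P>(\<omega> in M. N \<omega> = 0) = exp (- c)" by simp
  finally have "\<P>(\<omega> in M. Y \<omega> \<in> D) = 1 - exp (- c)" .
  then show ?thesis using D c by (intro bexI[of _ D]) auto
qed

end
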